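(* Let $\alpha\in(0,1]$ and $\tilde\Omega:=[a-b,b-a]$. Assume that: (a) $\tilde f(\cdot,z):\tilde\Omega\to\mathbb R^d$ is measurable for all $z\in Z$, and for every $r>0$ there is an integrable function $\tilde b_r:\tilde\Omega\to\mathbb R_+$ such that for Lebesgue-almost all $y\in\tilde\Omega$ one has $|\tilde f(y,z)|\le\tilde b_r(y)$ for all $z\in Z\cap\bar B_r(0)$; (b) for every $r>0$ there is an integrable function $\tilde l_r:\tilde\Omega\to\mathbb R_+$ such that for Lebesgue-almost all $y\in\tilde\Omega$ one has $|\tilde f(y,z)-\tilde f(y,\bar z)|\le\tilde l_r(y)|z-\bar z|$ for all $z,\bar z\in Z\cap\bar B_r(0)$. If $u\in U_\alpha$, $r>\|u\|_0$ and there exists a real $C\ge0$ satisfying $$\int_x^{\bar x}\tilde b_r(y)\,dy\le C(\bar x-x)^\alpha\quad\text{for all }a-b\le x\le\bar x\le b-a,$$ then the function $\tilde{\mathscr U}(u):[a,b]\to\mathbb R^d$, $\tilde{\mathscr U}(u)(x):=\int_a^b\tilde f(x-y,u(y))\,dy$, satisfies $\tilde{\mathscr U}(u)\in C^\alpha_d[a,b]$.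
   Context: $a<b$ are reals, $Z\subseteq\mathbb R^n$ is nonempty, $\tilde f:[a-b,b-a]\times Z\to\mathbb R^d$ is a function, and measurability/integrability refer to one-dimensional Lebesgue measure. $\mathbb R_+=[0,\infty)$, $|\cdot|$ denotes norms on finite-dimensional spaces, $\bar B_r(0)=\{z\in\mathbb R^n:|z|\le r\}$, $\|u\|_0=\sup_{x\in[a,b]}|u(x)|$. For $\alpha\in(0,1]$, $C^\alpha_m[a,b]$ is the space of functions $u:[a,b]\to\mathbb R^m$ with $[u]_\alpha:=\sup_{x\ne\bar x}|u(x)-u(\bar x)|/|x-\bar x|^\alpha<\infty$, and $U_\alpha:=\{u:[a,b]\to Z\mid u\in C^\alpha_n[a,b]\}$. *)

theory Defs
  imports "HOL-Analysis.Analysis"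
begin

text \<open>The norms on the finite-dimensional spaces are arbitrary, so they are passed as parameters
  instead of being fixed to the Euclidean \<^const>\<open>norm\<close>.\<close>

definition is_norm :: "('v::real_vector \<Rightarrow> real) \<Rightarrow> bool" where
  "is_norm N \<longleftrightarrow>
     (\<forall>v. 0 \<le> N v) \<and>
     (\<forall>v. N v = 0 \<longleftrightarrow> v = 0) \<and>
     (\<forall>c v. N (c *\<^sub>R v) = \<bar>c\<bar> * N v) \<and>
     (\<forall>v w. N (v + w) \<le> N v + N w)"

definition closed_norm_ball :: "('v \<Rightarrow> real) \<Rightarrow> real \<Rightarrow> 'v set" where
  "closed_norm_ball N r = {z. N z \<le> r}"

text \<open>A real supremum: it is meaningful only for bounded \<open>u\<close> and nonempty \<open>{a..b}\<close>.\<close>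

definition sup_norm :: "('v \<Rightarrow> real) \<Rightarrow> real \<Rightarrow> real \<Rightarrow> (real \<Rightarrow> 'v) \<Rightarrow> real" where
  "sup_norm N a b u = (SUP x\<in>{a..b}. N (u x))"

definition hoelder_seminorm ::
  "('v::real_vector \<Rightarrow> real) \<Rightarrow> real \<Rightarrow> real \<Rightarrow> real \<Rightarrow> (real \<Rightarrow> 'v) \<Rightarrow> ereal" where
  "hoelder_seminorm N \<alpha> a b u =
     (SUP (x, x') \<in> {(x, x'). x \<in> {a..b} \<and> x' \<in> {a..b} \<and> x \<noteq> x'}.
        ereal (N (u x - u x') / \<bar>x - x'\<bar> powr \<alpha>))"

text \<open>Functions on \<open>[a,b]\<close> are represented by total functions whose values outside
  \<open>{a..b}\<close> are irrelevant.\<close>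

definition hoelder_space ::
  "('v::real_vector \<Rightarrow> real) \<Rightarrow> real \<Rightarrow> real \<Rightarrow> real \<Rightarrow> (real \<Rightarrow> 'v) set" where
  "hoelder_space N \<alpha> a b = {u. hoelder_seminorm N \<alpha> a b u < \<infinity>}"

definition hoelder_domain ::
  "('v::real_vector \<Rightarrow> real) \<Rightarrow> 'v set \<Rightarrow> real \<Rightarrow> real \<Rightarrow> real \<Rightarrow> (real \<Rightarrow> 'v) set" where
  "hoelder_domain N Z \<alpha> a b = {u \<in> hoelder_space N \<alpha> a b. \<forall>x\<in>{a..b}. u x \<in> Z}"

definition convolution_operator ::
  "real \<Rightarrow> real \<Rightarrow> (real \<Rightarrow> 'v \<Rightarrow> 'w::euclidean_space) \<Rightarrow> (real \<Rightarrow> 'v) \<Rightarrow> real \<Rightarrow> 'w" where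
  "convolution_operator a b f u x = (LINT y|lebesgue_on {a..b}. f (x - y) (u y))"

end

theory Submission imports Defs begin

text \<open>
  The substitution \<open>t = x - y\<close> turns the operator into
  \<open>\<U>(x) = \<integral> t\<in>[x-b, x-a]. f(t, u(x-t))\<close>. In this form \<open>x\<close> no longer shifts the first argument
  of \<open>f\<close>, in which \<open>f\<close> is merely integrable; it only moves the window of integration and
  the argument of the Hoelder continuous function \<open>u\<close>.

  Let \<open>x \<le> x'\<close> and compare \<open>\<U>(x)\<close> with \<open>\<U>(x')\<close>. On the part \<open>[x'-b, x-a]\<close> common to the two
  windows the integrands differ by at most \<open>l(t) H (x'-x)\<^sup>\<alpha>\<close>, where \<open>H\<close> is a Hoelder constant of \<open>u\<close>.
  What is left are the end pieces \<open>[x-b, x'-b]\<close> and \<open>[x-a, x'-a]\<close>, on each of which the integral of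
  the majorant \<open>B(t)\<close> of \<open>f\<close> is at most \<open>C (x'-x)\<^sup>\<alpha>\<close> by hypothesis. The comparison at a fixed \<open>t\<close> is
  \<open>reflected_integrand_diff_bound\<close>; integrating it gives the Hoelder constant \<open>2 C + H \<integral>l\<close>, up to the
  factors that relate the given norm to the Euclidean one.

  The integrals make sense because \<open>t \<mapsto> f(t, u(x-t))\<close> is measurable: \<open>f\<close> is measurable in \<open>t\<close> and
  continuous in \<open>z\<close>, so one can replace \<open>u\<close> by step functions and pass to the limit
  (\<open>reflected_integrand_measurable\<close>). Both \<open>B\<close> and \<open>l\<close> belong to the radius \<open>r\<close>, which is legitimate
  since \<open>u\<close> takes its values in the ball of radius \<open>r\<close> (\<open>hoelder_le_sup_norm\<close>).
\<close>

section \<open>Norms on finite-dimensional spaces\<close>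

lemma is_norm_diff_commute:
  assumes "is_norm N"
  shows "N (v - w) = N (w - v)"
proof -
  have "N ((-1) *\<^sub>R (w - v)) = \<bar>-1\<bar> * N (w - v)"
    using assms unfolding is_norm_def by blast
  then show ?thesis by simp
qed

lemma is_norm_triangle_sub:
  assumes "is_norm N"
  shows "N v \<le> N w + N (v - w)"
proof -
  have "N (w + (v - w)) \<le> N w + N (v - w)"
    using assms unfolding is_norm_def by blast
  then show ?thesis by simp
qed

text \<open>Membership in a Hoelder space is insensitive to passing to an equivalent norm. This bound and
  the next one therefore allow all integrals to be estimated in the Euclidean norm.\<close>

lemma is_norm_le_norm:
  fixes M :: "'w::euclidean_space \<Rightarrow> real"
  assumes M: "is_norm M"
  obtains K where "0 < K" "\<And>v. M v \<le> K * norm v"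
proof
  let ?K = "(\<Sum>e\<in>Basis. M e) + 1"
  have nonneg: "0 \<le> M v" and scale: "M (c *\<^sub>R v) = \<bar>c\<bar> * M v" 
    and tri: "M (v + w) \<le> M v + M w" for v w c
    using M unfolding is_norm_def by blast+
  have M0: "M 0 = 0"
    using M unfolding is_norm_def by blast
  show "0 < ?K" by (simp add: add_nonneg_pos nonneg sum_nonneg)
  have sum_le: "M (\<Sum>e\<in>A. g e) \<le> (\<Sum>e\<in>A. M (g e))" if "finite A" for A :: "'w set" and g
    using that
  proof (induction A rule: finite_induct)
    case (insert e A)
    then show ?case using tri[of "g e" "sum g A"] by simp
  qed (simp add: M0)
  fix v
  have "M v = M (\<Sum>e\<in>Basis. (v \<bullet> e) *\<^sub>R e)" by (simp add: euclidean_representation)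
  also have "\<dots> \<le> (\<Sum>e\<in>Basis. \<bar>v \<bullet> e\<bar> * M e)"
    using sum_le[of Basis "\<lambda>e. (v \<bullet> e) *\<^sub>R e"] by (simp add: scale)
  also have "\<dots> \<le> (\<Sum>e\<in>Basis. norm v * M e)"
    by (intro sum_mono mult_right_mono Basis_le_norm nonneg)
  also have "\<dots> \<le> ?K * norm v"
    by (subst sum_distrib_left[symmetric]) (simp add: algebra_simps)
  finally show "M v \<le> ?K * norm v" .
qed

text \<open>By the opposite estimate \<open>M\<close> is Lipschitz continuous, hence attains a positive minimum on the
  compact Euclidean unit sphere; homogeneity does the rest.\<close>

lemma norm_le_is_norm:
  fixes M :: "'w::euclidean_space \<Rightarrow> real"
  assumes M: "is_norm M"
  obtains K where "0 < K" "\<And>v. norm v \<le> K * M v"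
proof -
  obtain L where L: "0 < L" "\<And>v. M v \<le> L * norm v"
    using is_norm_le_norm[OF M] by blast
  have lip: "\<bar>M v - M w\<bar> \<le> L * norm (v - w)" for v w
    using is_norm_triangle_sub[OF M, of v w] is_norm_triangle_sub[OF M, of w v]
      is_norm_diff_commute[OF M, of v w] L(2)[of "v - w"] by linarith
  have "L-lipschitz_on UNIV M"
    using lip L(1) by (intro lipschitz_onI) (auto simp: dist_norm)
  then have cont: "continuous_on (sphere 0 1) M"
    using lipschitz_on_continuous_on continuous_on_subset by blast
  have "sphere (0::'w) 1 \<noteq> {}" by simp
  then obtain e where e: "e \<in> sphere 0 1" "\<And>v. v \<in> sphere 0 1 \<Longrightarrow> M e \<le> M v"
    using continuous_attains_inf[OF compact_sphere _ cont] by blast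
  have scale: "M (c *\<^sub>R v) = \<bar>c\<bar> * M v" for c v
    using M unfolding is_norm_def by blast
  have M0: "M 0 = 0"
    using M unfolding is_norm_def by blast
  have "e \<noteq> 0" using e(1) by auto
  then have pos: "0 < M e"
    using M unfolding is_norm_def by (metis order_le_less)
  have "norm v \<le> (1 / M e) * M v" for v
  proof (cases "v = 0")
    case False
    then have "M e \<le> M ((1 / norm v) *\<^sub>R v)" by (intro e(2)) simp
    then have "M e \<le> M v / norm v" by (simp add: scale)
    then show ?thesis using False pos by (simp add: field_simps)
  qed (simp add: M0)
  then show ?thesis using that[of "1 / M e"] pos by simp
qed

section \<open>Hoelder functions\<close>

text \<open>The extended-real supremum is traded for a real constant. The case \<open>x = x'\<close>, excluded from the
  supremum, is harmless because both sides of the estimate vanish there.\<close>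

lemma hoelder_space_iff:
  assumes N: "is_norm N"
  shows "u \<in> hoelder_space N \<alpha> a b \<longleftrightarrow>
    (\<exists>H\<ge>0. \<forall>x\<in>{a..b}. \<forall>x'\<in>{a..b}. N (u x - u x') \<le> H * \<bar>x - x'\<bar> powr \<alpha>)"
    (is "?L \<longleftrightarrow> ?R")
proof
  let ?P = "{(x, x'). x \<in> {a..b} \<and> x' \<in> {a..b} \<and> x \<noteq> x'}"
  let ?q = "\<lambda>x x'. N (u x - u x') / \<bar>x - x'\<bar> powr \<alpha>"
  have nonneg: "0 \<le> N v" for v using N unfolding is_norm_def by blast
  have N0: "N 0 = 0" using N unfolding is_norm_def by blast
  show ?R if ?L
  proof -
    have "(SUP (x, x')\<in>?P. ereal (?q x x')) < \<infinity>"
      using that by (simp add: hoelder_space_def hoelder_seminorm_def)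
    then obtain n :: nat where "(SUP (x, x')\<in>?P. ereal (?q x x')) < ereal n"
      using less_PInf_Ex_of_nat by auto
    then obtain H where H: "(SUP (x, x')\<in>?P. ereal (?q x x')) \<le> ereal H"
      using less_imp_le by blast
    have "N (u x - u x') \<le> \<bar>H\<bar> * \<bar>x - x'\<bar> powr \<alpha>" if "x \<in> {a..b}" "x' \<in> {a..b}" for x x'
    proof (cases "x = x'")
      case False
      have "ereal (?q x x') \<le> (SUP (x, x')\<in>?P. ereal (?q x x'))"
        using that False by (intro SUP_upper2[of "(x, x')"]) auto
      with H have "?q x x' \<le> H" using order_trans ereal_less_eq(3) by blast
      then have "?q x x' \<le> \<bar>H\<bar>" by linarith
      then show ?thesis using False by (simp add: divide_le_eq)
    qed (simp add: N0)
    then show ?R by (intro exI[of _ "\<bar>H\<bar>"]) auto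
  qed
  show ?L if ?R
  proof -
    obtain H where H: "\<And>x x'. x \<in> {a..b} \<Longrightarrow> x' \<in> {a..b} \<Longrightarrow> N (u x - u x') \<le> H * \<bar>x - x'\<bar> powr \<alpha>"
      using \<open>?R\<close> by blast
    have "(SUP (x, x')\<in>?P. ereal (?q x x')) \<le> ereal H"
      by (rule SUP_least) (auto simp: divide_le_eq H)
    then show ?L
      by (auto simp: hoelder_space_def hoelder_seminorm_def)
  qed
qed

text \<open>\<^const>\<open>sup_norm\<close> dominates the pointwise norms only because a Hoelder function on a compact
  interval is bounded.\<close>

lemma hoelder_le_sup_norm:
  assumes N: "is_norm N" and u: "u \<in> hoelder_space N \<alpha> a b"
    and "0 < \<alpha>" and x: "x \<in> {a..b}"
  shows "N (u x) \<le> sup_norm N a b u"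
proof -
  obtain H where H: "0 \<le> H"
      "\<And>x x'. x \<in> {a..b} \<Longrightarrow> x' \<in> {a..b} \<Longrightarrow> N (u x - u x') \<le> H * \<bar>x - x'\<bar> powr \<alpha>"
    using u hoelder_space_iff[OF N] by blast
  have "N (u y) \<le> N (u a) + H * (b - a) powr \<alpha>" if y: "y \<in> {a..b}" for y
  proof -
    have "N (u y) \<le> N (u a) + N (u y - u a)" by (rule is_norm_triangle_sub[OF N])
    also have "N (u y - u a) \<le> H * \<bar>y - a\<bar> powr \<alpha>" using H(2)[of y a] y by simp
    also have "\<dots> \<le> H * (b - a) powr \<alpha>"
      using y H(1) \<open>0 < \<alpha>\<close> by (intro mult_left_mono powr_mono2) auto
    finally show ?thesis by simp
  qed
  then have "bdd_above ((\<lambda>x. N (u x)) ` {a..b})" by (intro bdd_aboveI2)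
  then show ?thesis unfolding sup_norm_def using x by (rule cSUP_upper2) auto
qed

section \<open>Lebesgue measurability and reflection\<close>

text \<open>This uses the completeness of Lebesgue measure: the limit may be changed arbitrarily on the
  exceptional null set.\<close>

lemma borel_measurable_lebesgue_LIMSEQ_AE:
  fixes g :: "'a::euclidean_space \<Rightarrow> 'w::euclidean_space"
  assumes meas: "\<And>n. h n \<in> borel_measurable lebesgue"
    and lim: "AE x in lebesgue. (\<lambda>n. h n x) \<longlonglongrightarrow> g x"
  shows "g \<in> borel_measurable lebesgue"
proof -
  obtain A where A: "A \<in> null_sets lebesgue" "{x. \<not> (\<lambda>n. h n x) \<longlonglongrightarrow> g x} \<subseteq> A"
    using lim unfolding eventually_ae_filter by auto
  have [measurable]: "A \<in> sets lebesgue" using A(1) by blast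
  have "(\<lambda>x. indicator (- A) x *\<^sub>R g x) \<in> borel_measurable lebesgue"
  proof (rule borel_measurable_LIMSEQ_metric)
    show "(\<lambda>x. indicator (- A) x *\<^sub>R h n x) \<in> borel_measurable lebesgue" for n
      using meas[of n] by measurable
    show "(\<lambda>n. indicator (- A) x *\<^sub>R h n x) \<longlonglongrightarrow> indicator (- A) x *\<^sub>R g x" for x
      using A(2) by (cases "x \<in> A") auto
  qed
  moreover have "AE x in lebesgue. indicator (- A) x *\<^sub>R g x = g x"
    using AE_not_in[OF A(1)] by eventually_elim simp
  ultimately show ?thesis by (rule borel_measurable_AE)
qed

lemma
  fixes g :: "real \<Rightarrow> 'w::euclidean_space"
  assumes g[measurable]: "g \<in> borel_measurable lebesgue"
  shows integrable_lebesgue_reflect: "integrable lebesgue (\<lambda>y. g (x - y)) \<longleftrightarrow> integrable lebesgue g"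
    and integral_lebesgue_reflect: "(LINT y|lebesgue. g (x - y)) = (LINT t|lebesgue. g t)"
proof -
  have [measurable]: "(\<lambda>y. x - y) \<in> lebesgue \<rightarrow>\<^sub>M lebesgue"
    using lebesgue_affine_measurable[of "\<lambda>_::real. -1" x] by simp
  have distr: "distr lebesgue lebesgue (\<lambda>y. x - y) = lebesgue"
    using lebesgue_real_affine[of "-1" x] by (simp add: density_1)
  show "integrable lebesgue (\<lambda>y. g (x - y)) \<longleftrightarrow> integrable lebesgue g"
    using integrable_distr_eq[of "\<lambda>y. x - y" lebesgue lebesgue g] by (simp add: distr)
  show "(LINT y|lebesgue. g (x - y)) = (LINT t|lebesgue. g t)"
    using integral_distr[of "\<lambda>y. x - y" lebesgue lebesgue g] by (simp add: distr)
qed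

section \<open>The reflected integrand\<close>

text \<open>The integrand of the convolution after the substitution \<open>t = x - y\<close>, extended by zero so that
  the functions for different \<open>x\<close> can be compared on the whole line.\<close>

definition reflected_integrand ::
  "real \<Rightarrow> real \<Rightarrow> (real \<Rightarrow> 'v \<Rightarrow> 'w::euclidean_space) \<Rightarrow> (real \<Rightarrow> 'v) \<Rightarrow> real \<Rightarrow> real \<Rightarrow> 'w" where
  "reflected_integrand a b f u x t = indicator {x - b..x - a} t *\<^sub>R f t (u (x - t))"

lemma reflected_integrand_reflect:
  "reflected_integrand a b f u x (x - y) = indicator {a..b} y *\<^sub>R f (x - y) (u y)"
  by (auto simp: reflected_integrand_def indicator_def)

lemma integrable_convolution_integrand_iff:
  assumes "reflected_integrand a b f u x \<in> borel_measurable lebesgue"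
  shows "integrable (lebesgue_on {a..b}) (\<lambda>y. f (x - y) (u y)) \<longleftrightarrow>
    integrable lebesgue (reflected_integrand a b f u x)"
  using integrable_lebesgue_reflect[OF assms, of x]
  by (simp add: integrable_restrict_space reflected_integrand_reflect)

lemma convolution_operator_eq_reflected:
  assumes "reflected_integrand a b f u x \<in> borel_measurable lebesgue"
  shows "convolution_operator a b f u x = (LINT t|lebesgue. reflected_integrand a b f u x t)"
  using integral_lebesgue_reflect[OF assms, of x]
  by (simp add: convolution_operator_def integral_restrict_space reflected_integrand_reflect)

text \<open>Truncation to \<open>[a,b]\<close> keeps the approximating points in the interval on which \<open>u\<close> is
  controlled; as it is continuous and fixes \<open>s\<close>, it does not affect the limit.\<close>

lemma tendsto_floor_approximation:
  fixes s :: real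
  assumes s: "s \<in> {a..b}"
  shows "(\<lambda>n. max a (min b (\<lfloor>real (Suc n) * s\<rfloor> / real (Suc n)))) \<longlonglongrightarrow> s"
proof -
  have lower_lim: "(\<lambda>n. s - inverse (real (Suc n))) \<longlonglongrightarrow> s"
    using tendsto_diff[OF tendsto_const[of s] LIMSEQ_inverse_real_of_nat] by simp
  have lower: "s - inverse (real (Suc n)) \<le> \<lfloor>real (Suc n) * s\<rfloor> / real (Suc n)"
    and upper: "\<lfloor>real (Suc n) * s\<rfloor> / real (Suc n) \<le> s" for n
  proof -
    have "real (Suc n) * s - 1 \<le> \<lfloor>real (Suc n) * s\<rfloor>" "\<lfloor>real (Suc n) * s\<rfloor> \<le> real (Suc n) * s"
      by linarith+
    then have "(real (Suc n) * s - 1) / real (Suc n) \<le> \<lfloor>real (Suc n) * s\<rfloor> / real (Suc n)"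
      "\<lfloor>real (Suc n) * s\<rfloor> / real (Suc n) \<le> (real (Suc n) * s) / real (Suc n)"
      by (intro divide_right_mono; simp)+
    then show "s - inverse (real (Suc n)) \<le> \<lfloor>real (Suc n) * s\<rfloor> / real (Suc n)"
      "\<lfloor>real (Suc n) * s\<rfloor> / real (Suc n) \<le> s"
      by (simp_all add: diff_divide_distrib inverse_eq_divide del: of_nat_Suc)
  qed
  have "(\<lambda>n. \<lfloor>real (Suc n) * s\<rfloor> / real (Suc n)) \<longlonglongrightarrow> s"
    by (rule tendsto_sandwich[OF always_eventually always_eventually lower_lim tendsto_const])
       (intro allI lower upper)+
  then have "(\<lambda>n. max a (min b (\<lfloor>real (Suc n) * s\<rfloor> / real (Suc n)))) \<longlonglongrightarrow> max a (min b s)"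
    by (intro tendsto_max tendsto_min tendsto_const)
  then show ?thesis using s by simp
qed

text \<open>Replacing \<open>s = x - t\<close> by its truncated floor approximation makes \<open>u\<close> piecewise constant with
  countably many values, all in \<open>Z\<close>, so that measurability of \<open>f\<close> for fixed second argument suffices.
  The Lipschitz condition and the Hoelder continuity of \<open>u\<close> give convergence for almost all \<open>t\<close>. The
  approximating values are values of \<open>u\<close>, which matters since \<open>Z\<close> is an arbitrary set and \<open>f\<close> is
  controlled only on it.\<close>

lemma reflected_integrand_measurable:
  fixes f :: "real \<Rightarrow> 'v::real_vector \<Rightarrow> 'w::euclidean_space"
  assumes ab: "a \<le> b" and x: "x \<in> {a..b}" and "0 < \<alpha>"
    and H: "\<And>s s'. s \<in> {a..b} \<Longrightarrow> s' \<in> {a..b} \<Longrightarrow> N (u s - u s') \<le> H * \<bar>s - s'\<bar> powr \<alpha>"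
    and uZ: "\<And>s. s \<in> {a..b} \<Longrightarrow> u s \<in> Z"
    and meas: "\<And>z. z \<in> Z \<Longrightarrow> (\<lambda>t. f t z) \<in> borel_measurable (lebesgue_on {a - b..b - a})"
    and lip: "AE t in lebesgue_on {a - b..b - a}. \<forall>z\<in>Z. \<forall>z'\<in>Z. norm (f t z - f t z') \<le> l t * N (z - z')"
    and l: "\<And>t. t \<in> {a - b..b - a} \<Longrightarrow> 0 \<le> l t"
  shows "reflected_integrand a b f u x \<in> borel_measurable lebesgue"
proof -
  define D where "D = {a - b..b - a}"
  define p where "p = (\<lambda>(n::nat) (k::int). max a (min b (real_of_int k / real (Suc n))))"
  define h where "h = (\<lambda>n t. indicator {x - b..x - a} t *\<^sub>R
    (indicator D t *\<^sub>R f t (u (p n \<lfloor>real (Suc n) * (x - t)\<rfloor>))))"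
  have p: "p n k \<in> {a..b}" for n k
    using ab by (auto simp: p_def)
  have sub: "{x - b..x - a} \<subseteq> D"
    using x by (auto simp: D_def)
  show ?thesis
  proof (rule borel_measurable_lebesgue_LIMSEQ_AE)
    fix n
    have "(\<lambda>t. indicator D t *\<^sub>R f t (u (p n k))) \<in> borel_measurable lebesgue" for k
      using meas[OF uZ[OF p]]
      by (simp add: borel_measurable_restrict_space_iff D_def)
    moreover have "(\<lambda>t. real (Suc n) * (x - t)) \<in> borel_measurable lebesgue"
      by (intro measurable_completion) measurable
    then have "(\<lambda>t. \<lfloor>real (Suc n) * (x - t)\<rfloor>) \<in> lebesgue \<rightarrow>\<^sub>M count_space UNIV"
      by (rule measurable_compose[OF _ measurable_real_floor])
    ultimately have "(\<lambda>t. indicator D t *\<^sub>R f t (u (p n \<lfloor>real (Suc n) * (x - t)\<rfloor>)))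
        \<in> borel_measurable lebesgue"
      by (rule measurable_compose_countable'[where I = UNIV and
          f = "\<lambda>k t. indicator D t *\<^sub>R f t (u (p n k))"]) simp_all
    then show "h n \<in> borel_measurable lebesgue"
      unfolding h_def by (rule borel_measurable_scaleR[rotated]) (simp add: borel_measurable_indicator)
  next
    have "AE t in lebesgue. t \<in> D \<longrightarrow> (\<forall>z\<in>Z. \<forall>z'\<in>Z. norm (f t z - f t z') \<le> l t * N (z - z'))"
      using lip by (simp add: AE_restrict_space_iff D_def)
    then show "AE t in lebesgue. (\<lambda>n. h n t) \<longlonglongrightarrow> reflected_integrand a b f u x t"
    proof eventually_elim
      case (elim t)
      show ?case
      proof (cases "t \<in> {x - b..x - a}")
        case True
        with sub have tD: "t \<in> D" by blast
        define s where "s = x - t"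
        define q where "q = (\<lambda>n. p n \<lfloor>real (Suc n) * s\<rfloor>)"
        have s: "s \<in> {a..b}" using True by (auto simp: s_def)
        have "q \<longlonglongrightarrow> s"
          using tendsto_floor_approximation[OF s] by (simp add: q_def p_def)
        then have "(\<lambda>n. \<bar>q n - s\<bar>) \<longlonglongrightarrow> 0"
          by (intro tendsto_rabs_zero) (simp add: LIM_zero)
        then have "(\<lambda>n. \<bar>q n - s\<bar> powr \<alpha>) \<longlonglongrightarrow> 0"
          using \<open>0 < \<alpha>\<close> tendsto_powr'[of "\<lambda>n. \<bar>q n - s\<bar>" 0 sequentially "\<lambda>_. \<alpha>" \<alpha>] by simp
        then have bound: "(\<lambda>n. l t * (H * \<bar>q n - s\<bar> powr \<alpha>)) \<longlonglongrightarrow> 0"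
          by (intro tendsto_mult_right_zero)
        have "norm (f t (u (q n)) - f t (u s)) \<le> l t * (H * \<bar>q n - s\<bar> powr \<alpha>)" for n
        proof -
          have q: "q n \<in> {a..b}" unfolding q_def by (rule p)
          have "norm (f t (u (q n)) - f t (u s)) \<le> l t * N (u (q n) - u s)"
            using elim tD uZ[OF q] uZ[OF s] by blast
          also have "\<dots> \<le> l t * (H * \<bar>q n - s\<bar> powr \<alpha>)"
            using H[OF q s] l[of t] tD by (intro mult_left_mono) (auto simp: D_def)
          finally show ?thesis .
        qed
        then have "(\<lambda>n. f t (u (q n)) - f t (u s)) \<longlonglongrightarrow> 0"
          by (intro Lim_null_comparison[OF _ bound]) auto
        then have "(\<lambda>n. f t (u (q n))) \<longlonglongrightarrow> f t (u s)"
          by (rule LIM_zero_cancel)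
        then show ?thesis
          using True tD by (simp add: h_def reflected_integrand_def q_def s_def)
      qed (simp add: h_def reflected_integrand_def)
    qed
  qed
qed

text \<open>Moving \<open>x\<close> to \<open>x'\<close> moves the window \<open>[x-b, x-a]\<close>: on the two end pieces only one of the
  integrands is present and \<open>B\<close> bounds it; on the overlap both are, and the Lipschitz condition
  sees the increment of \<open>u\<close>.\<close>

lemma reflected_integrand_diff_bound:
  assumes x: "x \<in> {a..b}" and x': "x' \<in> {a..b}" and "x \<le> x'"
    and uZ: "\<And>s. s \<in> {a..b} \<Longrightarrow> u s \<in> Z"
    and H: "\<And>s s'. s \<in> {a..b} \<Longrightarrow> s' \<in> {a..b} \<Longrightarrow> N (u s - u s') \<le> H * \<bar>s - s'\<bar> powr \<alpha>"
    and bound: "\<And>z. z \<in> Z \<Longrightarrow> norm (f t z) \<le> B"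
    and lip: "\<And>z z'. z \<in> Z \<Longrightarrow> z' \<in> Z \<Longrightarrow> norm (f t z - f t z') \<le> L * N (z - z')"
    and nonneg: "0 \<le> B" "0 \<le> L" "0 \<le> H"
  shows "norm (reflected_integrand a b f u x' t - reflected_integrand a b f u x t)
    \<le> indicator {x - b..x' - b} t * B + indicator {x - a..x' - a} t * B
      + L * (H * (x' - x) powr \<alpha>)" (is "_ \<le> ?E1 + ?E2 + ?O")
proof -
  have E: "0 \<le> ?E1" "0 \<le> ?E2" "0 \<le> ?O" using nonneg by simp_all
  have inside: "reflected_integrand a b f u y t = f t (u (y - t))" if "t \<in> {y - b..y - a}" for y
    unfolding reflected_integrand_def indicator_simps(1)[OF that] by (rule scaleR_one)
  have outside: "reflected_integrand a b f u y t = 0" if "t \<notin> {y - b..y - a}" for y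
    unfolding reflected_integrand_def indicator_simps(2)[OF that] by (rule scaleR_zero_left)
  consider "t \<in> {x - b..x - a}" "t \<in> {x' - b..x' - a}"
    | "t \<in> {x - b..x - a}" "t \<notin> {x' - b..x' - a}"
    | "t \<notin> {x - b..x - a}" "t \<in> {x' - b..x' - a}"
    | "t \<notin> {x - b..x - a}" "t \<notin> {x' - b..x' - a}" by blast
  then show ?thesis
  proof cases
    case 1
    then have s: "x - t \<in> {a..b}" "x' - t \<in> {a..b}" by auto
    have "norm (f t (u (x' - t)) - f t (u (x - t))) \<le> L * N (u (x' - t) - u (x - t))"
      by (intro lip uZ s)
    also have "\<dots> \<le> ?O"
      using H[OF s(2) s(1)] nonneg(2) \<open>x \<le> x'\<close> by (intro mult_left_mono) simp_all
    finally have "norm (f t (u (x' - t)) - f t (u (x - t))) \<le> ?O" .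
    then show ?thesis unfolding inside[OF 1(1)] inside[OF 1(2)] using E(1,2) by linarith
  next
    case 2
    then have t: "t \<in> {x - b..x' - b}" "x - t \<in> {a..b}" using \<open>x \<le> x'\<close> by auto
    have "norm (f t (u (x - t))) \<le> B" by (intro bound uZ t(2))
    moreover have "?E1 = B" using t(1) by simp
    ultimately show ?thesis
      unfolding inside[OF 2(1)] outside[OF 2(2)] diff_0 norm_minus_cancel using E(2,3) by linarith
  next
    case 3
    then have t: "t \<in> {x - a..x' - a}" "x' - t \<in> {a..b}" using \<open>x \<le> x'\<close> by auto
    have "norm (f t (u (x' - t))) \<le> B" by (intro bound uZ t(2))
    moreover have "?E2 = B" using t(1) by simp
    ultimately show ?thesis
      unfolding outside[OF 3(1)] inside[OF 3(2)] diff_0_right using E(1,3) by linarith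
  next
    case 4
    show ?thesis
      unfolding outside[OF 4(1)] outside[OF 4(2)] diff_0_right norm_zero using E by linarith
  qed
qed

section \<open>Hoelder continuity of the convolution operator\<close>

theorem theorem2p13:
  fixes a b \<alpha> r C :: real
    and Z :: "(real ^ 'n) set"
    and f :: "real \<Rightarrow> real ^ 'n \<Rightarrow> real ^ 'd"
    and N :: "real ^ 'n \<Rightarrow> real"
    and M :: "real ^ 'd \<Rightarrow> real"
    and bb ll :: "real \<Rightarrow> real \<Rightarrow> real"
    and u :: "real \<Rightarrow> real ^ 'n"
  assumes norms: "is_norm N" "is_norm M"
    and ab: "a < b"
    and Z_nonempty: "Z \<noteq> {}"
    and alpha: "0 < \<alpha>" "\<alpha> \<le> 1"
    and f_measurable:
      "\<forall>z\<in>Z. (\<lambda>y. f y z) \<in> borel_measurable (lebesgue_on {a - b..b - a})"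
    and f_bound:
      "\<forall>s>0. integrable (lebesgue_on {a - b..b - a}) (bb s) \<and>
         (\<forall>y\<in>{a - b..b - a}. 0 \<le> bb s y) \<and>
         (AE y in lebesgue_on {a - b..b - a}.
            \<forall>z\<in>Z \<inter> closed_norm_ball N s. M (f y z) \<le> bb s y)"
    and f_lipschitz:
      "\<forall>s>0. integrable (lebesgue_on {a - b..b - a}) (ll s) \<and>
         (\<forall>y\<in>{a - b..b - a}. 0 \<le> ll s y) \<and>
         (AE y in lebesgue_on {a - b..b - a}.
            \<forall>z\<in>Z \<inter> closed_norm_ball N s. \<forall>z'\<in>Z \<inter> closed_norm_ball N s.
              M (f y z - f y z') \<le> ll s y * N (z - z'))"
    and u: "u \<in> hoelder_domain N Z \<alpha> a b"
    and r: "sup_norm N a b u < r"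
    and C: "0 \<le> C"
    and bound_hoelder:
      "\<forall>x x'. a - b \<le> x \<and> x \<le> x' \<and> x' \<le> b - a \<longrightarrow>
         (LINT y|lebesgue_on {x..x'}. bb r y) \<le> C * (x' - x) powr \<alpha>"
  shows "(\<forall>x\<in>{a..b}. integrable (lebesgue_on {a..b}) (\<lambda>y. f (x - y) (u y))) \<and>
         convolution_operator a b f u \<in> hoelder_space M \<alpha> a b"
proof -
  define D where "D = {a - b..b - a}"
  define Zr where "Zr = Z \<inter> closed_norm_ball N r"
  have N_nonneg: "0 \<le> N v" for v using norms(1) unfolding is_norm_def by blast
  have u': "u \<in> hoelder_space N \<alpha> a b" using u by (simp add: hoelder_domain_def)
  then obtain H where H: "0 \<le> H"
      "\<And>s s'. s \<in> {a..b} \<Longrightarrow> s' \<in> {a..b} \<Longrightarrow> N (u s - u s') \<le> H * \<bar>s - s'\<bar> powr \<alpha>"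
    using hoelder_space_iff[OF norms(1)] by blast
  have u_less: "N (u s) < r" if "s \<in> {a..b}" for s
    using hoelder_le_sup_norm[OF norms(1) u' alpha(1) that] r by linarith
  have uZ: "u s \<in> Zr" if "s \<in> {a..b}" for s
    using u that less_imp_le[OF u_less[OF that]]
    by (simp add: Zr_def hoelder_domain_def closed_norm_ball_def)
  have "0 < r" using u_less[of a] N_nonneg[of "u a"] ab by simp
  have bb: "integrable (lebesgue_on D) (bb r)" "\<And>t. t \<in> D \<Longrightarrow> 0 \<le> bb r t"
      "AE t in lebesgue_on D. \<forall>z\<in>Zr. M (f t z) \<le> bb r t"
    and ll: "integrable (lebesgue_on D) (ll r)" "\<And>t. t \<in> D \<Longrightarrow> 0 \<le> ll r t"
      "AE t in lebesgue_on D. \<forall>z\<in>Zr. \<forall>z'\<in>Zr. M (f t z - f t z') \<le> ll r t * N (z - z')"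
    using f_bound[rule_format, OF \<open>0 < r\<close>] f_lipschitz[rule_format, OF \<open>0 < r\<close>]
    unfolding D_def Zr_def by simp_all
  obtain K where K: "0 < K" "\<And>v. norm v \<le> K * M v"
    using norm_le_is_norm[OF norms(2)] by blast
  obtain K' where K': "0 < K'" "\<And>v. M v \<le> K' * norm v"
    using is_norm_le_norm[OF norms(2)] by blast
  \<comment> \<open>The dominating functions, rescaled to the Euclidean norm and extended by zero.\<close>
  define B where "B = (\<lambda>t. K * (indicator D t * bb r t))"
  define L where "L = (\<lambda>t. K * (indicator D t * ll r t))"
  have D_sets: "D \<in> sets lebesgue" by (simp add: D_def)
  have B_int: "integrable lebesgue B" and L_int: "integrable lebesgue L"
    using bb(1) ll(1) D_sets by (simp_all add: B_def L_def integrable_restrict_space)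
  have B_nonneg: "0 \<le> B t" and L_nonneg: "0 \<le> L t" for t
    using bb(2) ll(2) K(1) by (auto simp: B_def L_def indicator_def)
  have norm_leI: "norm v \<le> K * c" if "M v \<le> c" for v c
    using K(2)[of v] mult_left_mono[OF that, of K] K(1) by linarith
  have bound: "AE t in lebesgue_on D. \<forall>z\<in>Zr. norm (f t z) \<le> B t"
    using bb(3) AE_space
  proof eventually_elim
    case (elim t)
    then have "B t = K * bb r t" using D_sets by (simp add: B_def)
    then show ?case using elim(1) norm_leI by simp
  qed
  have lip: "AE t in lebesgue_on D. \<forall>z\<in>Zr. \<forall>z'\<in>Zr. norm (f t z - f t z') \<le> L t * N (z - z')"
    using ll(3) AE_space
  proof eventually_elim
    case (elim t)
    then have "L t = K * ll r t" using D_sets by (simp add: L_def)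
    then show ?case using elim(1) norm_leI by (simp add: mult.assoc)
  qed
  have bound': "AE t in lebesgue. t \<in> D \<longrightarrow> (\<forall>z\<in>Zr. norm (f t z) \<le> B t)"
    and lip': "AE t in lebesgue. t \<in> D \<longrightarrow>
      (\<forall>z\<in>Zr. \<forall>z'\<in>Zr. norm (f t z - f t z') \<le> L t * N (z - z'))"
    using bound lip by (simp_all add: AE_restrict_space_iff D_def)
  define F where "F = reflected_integrand a b f u"
  have F_meas: "F x \<in> borel_measurable lebesgue" if "x \<in> {a..b}" for x
    unfolding F_def
  proof (rule reflected_integrand_measurable[where Z = Zr and l = L and N = N and H = H and \<alpha> = \<alpha>])
    show "(\<lambda>t. f t z) \<in> borel_measurable (lebesgue_on {a - b..b - a})" if "z \<in> Zr" for z
      using f_measurable that by (simp add: Zr_def)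
  qed ((fact less_imp_le[OF ab] that alpha(1) H(2) uZ lip[unfolded D_def])+, rule L_nonneg)
  have F_int: "integrable lebesgue (F x)" if x: "x \<in> {a..b}" for x
  proof (rule Bochner_Integration.integrable_bound[OF B_int F_meas[OF x]])
    show "AE t in lebesgue. norm (F x t) \<le> norm (B t)"
      using bound'
    proof eventually_elim
      case (elim t)
      show ?case
      proof (cases "t \<in> {x - b..x - a}")
        case True
        then have "t \<in> D" "x - t \<in> {a..b}" using x by (auto simp: D_def)
        then show ?thesis using elim uZ True B_nonneg[of t]
          by (simp add: F_def reflected_integrand_def)
      qed (simp add: F_def reflected_integrand_def)
    qed
  qed
  have U_eq: "convolution_operator a b f u x = (LINT t|lebesgue. F x t)" if "x \<in> {a..b}" for x
    using convolution_operator_eq_reflected[OF F_meas[OF that, unfolded F_def]] by (simp add: F_def)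
  have end_piece: "(LINT t|lebesgue. indicator {c..d} t * B t) \<le> K * (C * (d - c) powr \<alpha>)"
    if "a - b \<le> c" "c \<le> d" "d \<le> b - a" for c d
  proof -
    have "(LINT t|lebesgue. indicator {c..d} t * B t)
        = (LINT t|lebesgue. K * (indicator {c..d} t * bb r t))"
      using that by (intro Bochner_Integration.integral_cong) (auto simp: B_def D_def indicator_def)
    also have "\<dots> = K * (LINT t|lebesgue_on {c..d}. bb r t)"
      by (simp add: integral_restrict_space)
    also have "\<dots> \<le> K * (C * (d - c) powr \<alpha>)"
      using bound_hoelder that K(1) by (intro mult_left_mono) auto
    finally show ?thesis .
  qed
  define Q where "Q = 2 * (K * C) + (LINT t|lebesgue. L t) * H"
  have increment: "norm ((LINT t|lebesgue. F x' t) - (LINT t|lebesgue. F x t)) \<le> Q * (x' - x) powr \<alpha>"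
    if x: "x \<in> {a..b}" and x': "x' \<in> {a..b}" and "x \<le> x'" for x x'
  proof -
    let ?E1 = "\<lambda>t. indicator {x - b..x' - b} t * B t"
    let ?E2 = "\<lambda>t. indicator {x - a..x' - a} t * B t"
    let ?O = "\<lambda>t. L t * (H * (x' - x) powr \<alpha>)"
    have ints: "integrable lebesgue ?E1" "integrable lebesgue ?E2" "integrable lebesgue ?O"
      using integrable_mult_indicator[OF _ B_int] L_int by auto
    have "AE t in lebesgue. norm (F x' t - F x t) \<le> ?E1 t + ?E2 t + ?O t"
      using bound' lip'
    proof eventually_elim
      case (elim t)
      show ?case
      proof (cases "t \<in> D")
        case True
        with elim have at_t: "\<And>z. z \<in> Zr \<Longrightarrow> norm (f t z) \<le> B t"
          "\<And>z z'. z \<in> Zr \<Longrightarrow> z' \<in> Zr \<Longrightarrow> norm (f t z - f t z') \<le> L t * N (z - z')"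
          by blast+
        show ?thesis unfolding F_def
          by (rule reflected_integrand_diff_bound[where Z = Zr and N = N])
             (fact x x' \<open>x \<le> x'\<close> uZ H at_t B_nonneg L_nonneg)+
      next
        case False
        then have "t \<notin> {x - b..x - a}" "t \<notin> {x' - b..x' - a}"
          using x x' by (auto simp: D_def)
        then show ?thesis
          using B_nonneg[of t] L_nonneg[of t] H(1)
          by (simp add: F_def reflected_integrand_def del: atLeastAtMost_iff)
      qed
    qed
    then have "(LINT t|lebesgue. norm (F x' t - F x t)) \<le> (LINT t|lebesgue. ?E1 t + ?E2 t + ?O t)"
      using F_int x x' ints by (intro integral_mono_AE) auto
    also have "\<dots> = (LINT t|lebesgue. ?E1 t) + (LINT t|lebesgue. ?E2 t) + (LINT t|lebesgue. ?O t)"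
      using ints by simp
    also have "\<dots> \<le> K * (C * (x' - x) powr \<alpha>) + K * (C * (x' - x) powr \<alpha>)
        + (LINT t|lebesgue. L t) * (H * (x' - x) powr \<alpha>)"
      using end_piece[of "x - b" "x' - b"] end_piece[of "x - a" "x' - a"] x x' \<open>x \<le> x'\<close>
      by (intro add_mono) auto
    also have "\<dots> = Q * (x' - x) powr \<alpha>"
      by (simp add: Q_def algebra_simps)
    finally have "(LINT t|lebesgue. norm (F x' t - F x t)) \<le> Q * (x' - x) powr \<alpha>" .
    moreover have "norm ((LINT t|lebesgue. F x' t) - (LINT t|lebesgue. F x t))
        \<le> (LINT t|lebesgue. norm (F x' t - F x t))"
      using F_int[OF x] F_int[OF x'] integral_norm_bound[of lebesgue "\<lambda>t. F x' t - F x t"] by simp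
    ultimately show ?thesis by linarith
  qed
  have hoelder: "M (convolution_operator a b f u x - convolution_operator a b f u x')
      \<le> (K' * Q) * \<bar>x - x'\<bar> powr \<alpha>" if x: "x \<in> {a..b}" and x': "x' \<in> {a..b}" for x x'
  proof -
    have "norm (convolution_operator a b f u x - convolution_operator a b f u x')
        \<le> Q * \<bar>x - x'\<bar> powr \<alpha>"
      using increment[OF x x'] increment[OF x' x] U_eq x x'
      by (cases "x \<le> x'") (auto simp: norm_minus_commute abs_minus_commute)
    then have "K' * norm (convolution_operator a b f u x - convolution_operator a b f u x')
        \<le> K' * (Q * \<bar>x - x'\<bar> powr \<alpha>)"
      using K'(1) by (intro mult_left_mono) auto
    then show ?thesis
      using order_trans[OF K'(2)] by (simp add: mult.assoc)
  qed
  have "0 \<le> Q"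
    using K(1) C H(1) L_nonneg by (simp add: Q_def)
  then have "0 \<le> K' * Q" using K'(1) by simp
  show ?thesis
  proof
    show "\<forall>x\<in>{a..b}. integrable (lebesgue_on {a..b}) (\<lambda>y. f (x - y) (u y))"
      using integrable_convolution_integrand_iff[OF F_meas[unfolded F_def]] F_int[unfolded F_def]
      by blast
    show "convolution_operator a b f u \<in> hoelder_space M \<alpha> a b"
      using hoelder \<open>0 \<le> K' * Q\<close> hoelder_space_iff[OF norms(2)] by blast
  qed
qed

end
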